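(* The common dual relation $\sim$ is not transitive on the set of planar graphs: there exist planar graphs $G_1,G_2,G_3$ with $G_1\sim G_2$ and $G_2\sim G_3$ but $G_1\not\sim G_3$.
   Context: Graphs may have multiple edges and loops. For a planar graph $G$ with planar embedding $\mathcal{G}$, the dual of $G$ with respect to $\mathcal{G}$ has one vertex per face of $\mathcal{G}$ and one edge $e^\star$ per edge $e$ of $G$, joining the two faces incident to $e$. The common dual relation $\sim$: for planar graphs $G_1,G_2$, $G_1\sim G_2$ iff there are planar embeddings of $G_1$ and $G_2$ such that the corresponding dual graphs are isomorphic. *)

theory Defs
  imports "HOL-Analysis.Analysis"
begin

text \<open>
  Undirected graphs with parallel edges and loops: an edge is mapped to the set of its ends,
  which has two elements for a proper edge and one element for a loop.
\<close>

record ('v, 'e) multigraph =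
  verts :: "'v set"
  edges :: "'e set"
  ends :: "'e \<Rightarrow> 'v set"

definition finite_multigraph :: "('v, 'e) multigraph \<Rightarrow> bool" where
  "finite_multigraph G \<longleftrightarrow>
     finite (verts G) \<and> finite (edges G) \<and>
     (\<forall>e \<in> edges G. ends G e \<subseteq> verts G \<and> (card (ends G e) = 1 \<or> card (ends G e) = 2))"

definition isomorphic_multigraphs ::
    "('v, 'e) multigraph \<Rightarrow> ('w, 'f) multigraph \<Rightarrow> bool" where
  "isomorphic_multigraphs G H \<longleftrightarrow>
     (\<exists>f g. bij_betw f (verts G) (verts H) \<and> bij_betw g (edges G) (edges H) \<and>
            (\<forall>e \<in> edges G. ends H (g e) = f ` ends G e))"

definition open_curve :: "(real \<Rightarrow> complex) \<Rightarrow> complex set" where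
  "open_curve \<gamma> = \<gamma> ` {0<..<1}"

text \<open>
  An embedding in the plane (identified with the complex numbers) consists of the vertex
  positions \<open>p\<close> and, for each edge, a parametrized curve. A simple path may be closed; since
  its two end points are the positions of the ends of the edge and \<open>p\<close> is injective, it is
  closed exactly for loops and an arc otherwise.
\<close>

definition planar_embedding ::
    "('v, 'e) multigraph \<Rightarrow> ('v \<Rightarrow> complex) \<Rightarrow> ('e \<Rightarrow> real \<Rightarrow> complex) \<Rightarrow> bool" where
  "planar_embedding G p c \<longleftrightarrow>
     inj_on p (verts G) \<and>
     (\<forall>e \<in> edges G. simple_path (c e) \<and>
        {pathstart (c e), pathfinish (c e)} = p ` ends G e \<and>
        open_curve (c e) \<inter> p ` verts G = {}) \<and>
     (\<forall>e \<in> edges G. \<forall>e' \<in> edges G. e \<noteq> e' \<longrightarrow> open_curve (c e) \<inter> open_curve (c e') = {})"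

definition planar_graph :: "('v, 'e) multigraph \<Rightarrow> bool" where
  "planar_graph G \<longleftrightarrow> finite_multigraph G \<and> (\<exists>p c. planar_embedding G p c)"

definition embedding_faces ::
    "('v, 'e) multigraph \<Rightarrow> ('v \<Rightarrow> complex) \<Rightarrow> ('e \<Rightarrow> real \<Rightarrow> complex) \<Rightarrow> complex set set" where
  "embedding_faces G p c =
     components (- (p ` verts G \<union> (\<Union>e \<in> edges G. path_image (c e))))"

text \<open>
  The edge \<open>e\<close> itself serves as the name of its dual edge. Its ends are the faces whose boundary
  contains the curve of \<open>e\<close>: two faces in general, and a single one (so that the dual edge is a
  loop) if \<open>e\<close> has the same face on both sides.
\<close>

definition dual_graph ::
    "('v, 'e) multigraph \<Rightarrow> ('v \<Rightarrow> complex) \<Rightarrow> ('e \<Rightarrow> real \<Rightarrow> complex) \<Rightarrow>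
     (complex set, 'e) multigraph" where
  "dual_graph G p c =
     \<lparr>verts = embedding_faces G p c,
      edges = edges G,
      ends = (\<lambda>e. {F \<in> embedding_faces G p c. path_image (c e) \<subseteq> frontier F})\<rparr>"

definition common_dual :: "('v, 'e) multigraph \<Rightarrow> ('w, 'f) multigraph \<Rightarrow> bool" where
  "common_dual G\<^sub>1 G\<^sub>2 \<longleftrightarrow>
     (\<exists>p\<^sub>1 c\<^sub>1 p\<^sub>2 c\<^sub>2. planar_embedding G\<^sub>1 p\<^sub>1 c\<^sub>1 \<and> planar_embedding G\<^sub>2 p\<^sub>2 c\<^sub>2 \<and>
        isomorphic_multigraphs (dual_graph G\<^sub>1 p\<^sub>1 c\<^sub>1) (dual_graph G\<^sub>2 p\<^sub>2 c\<^sub>2))"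

end

theory Submission
  imports Defs
begin

text \<open>
  All three graphs consist of the theta graph \<open>K\<^bsub>2,3\<^esub>\<close> and three further edges: pendant edges at the three
  middle vertices, three isolated edges, or a disjoint path of length three. Drawing such a tree-like
  part into a face of the theta graph does not separate that face (Janiszewski), so the dual
  is the dual of the theta graph with one loop per extra edge, placed at the face that
  contains it. Isolated edges can be drawn anywhere, hence the second graph has a common dual with
  both others. The path lies in a single face, so its three loops sit at one dual vertex; but
  every face of a theta graph avoids one of the three middle vertices, so the three
  pendant edges never yield loops at one vertex.
\<close>

subsection \<open>Adding nonseparating sets\<close>

text \<open>Transitivity fails because the middle graph may use two embeddings whose duals are not
  isomorphic: its isolated edges are drawn once beside the middle vertices and once in a row far to
  the right. The positive half never computes a face. Both drawings of a pair use the same curves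
  for the theta graph, the isomorphism is the identity on edges, and for an extra edge it is enough
  that its two curves share a point, since this point fixes the face of the theta graph. The
  negative half has to treat arbitrary embeddings by arbitrary curves, so the three faces of a theta
  curve and their frontiers are derived from the Jordan curve theorem and Janiszewski's theorem. An
  isomorphism of duals may also permute the edges. The extra edges are recognized as the loops of
  the dual, because every edge of the theta graph borders two distinct faces. Pendant edges at the
  poles would not do, as the poles lie on the boundary of all three faces; hence each arc is
  subdivided by a middle vertex.\<close>

locale nonseparating_addition =
  fixes K T :: "complex set"
  assumes closed_base: "closed K" and closed_addition: "closed T"
    and interior_addition: "interior T = {}"
    and connected_component_addition:
      "\<lbrakk>x \<notin> T; y \<notin> T; connected_component (- K) x y\<rbrakk> \<Longrightarrow> connected_component (- (K \<union> T)) x y"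
begin

text \<open>The complement of a set with empty interior is dense, so an open set loses nothing of
  its closure. This is why incidence with a face can be tested on the closure of the face before
  \<open>T\<close> was added.\<close>

lemma closure_diff_addition:
  assumes "open F"
  shows "closure (F - T) = closure F"
proof
  have "F \<inter> closure (- T) \<subseteq> closure (F \<inter> - T)"
    by (rule open_Int_closure_subset[OF assms])
  then have "F \<subseteq> closure (F - T)"
    by (simp add: closure_complement interior_addition Diff_eq)
  then show "closure F \<subseteq> closure (F - T)"
    by (rule closure_minimal) simp
qed (simp add: closure_mono)

lemma face_minus_addition_nonempty:
  assumes "F \<in> components (- K)"
  shows "F - T \<noteq> {}"
proof -
  have "open F"
    using assms closed_base by (auto intro: open_components)
  then show ?thesis
    using closure_diff_addition[of F] in_components_nonempty[OF assms]
    by (metis closure_empty closure_subset subset_empty)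
qed

lemma connected_component_set_addition:
  assumes "x \<notin> T"
  shows "connected_component_set (- (K \<union> T)) x = connected_component_set (- K) x - T"
proof
  show "connected_component_set (- (K \<union> T)) x \<subseteq> connected_component_set (- K) x - T"
    using connected_component_subset[of "- (K \<union> T)" x]
      connected_component_mono[of "- (K \<union> T)" "- K" x] by blast
  show "connected_component_set (- K) x - T \<subseteq> connected_component_set (- (K \<union> T)) x"
    using connected_component_addition assms by auto
qed

text \<open>Together with the injectivity below, \<open>F \<mapsto> F - T\<close> becomes the
  bijection from the faces of the base to the faces of the full drawing.\<close>

lemma components_addition:
  "components (- (K \<union> T)) = (\<lambda>F. F - T) ` components (- K)"
proof (intro equalityI subsetI)
  fix F assume "F \<in> components (- (K \<union> T))"
  then obtain x where x: "x \<notin> K" "x \<notin> T" "F = connected_component_set (- (K \<union> T)) x"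
    by (auto simp: components_iff)
  then have "F = connected_component_set (- K) x - T"
    using connected_component_set_addition by metis
  moreover have "connected_component_set (- K) x \<in> components (- K)"
    using x by (simp add: componentsI)
  ultimately show "F \<in> (\<lambda>F. F - T) ` components (- K)"
    by blast
next
  fix F' assume "F' \<in> (\<lambda>F. F - T) ` components (- K)"
  then obtain F where F: "F \<in> components (- K)" "F' = F - T" by auto
  then obtain x where x: "x \<in> F" "x \<notin> T"
    using face_minus_addition_nonempty by blast
  have "x \<notin> K"
    using x in_components_subset[OF F(1)] by blast
  have "F = connected_component_set (- K) x"
    using F(1) x(1) by (metis components_iff connected_component_eq)
  then have "F' = connected_component_set (- (K \<union> T)) x"
    using F(2) connected_component_set_addition[OF x(2)] by simp
  then show "F' \<in> components (- (K \<union> T))"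
    using x \<open>x \<notin> K\<close> by (simp add: componentsI)
qed

lemma inj_on_face_minus_addition: "inj_on (\<lambda>F. F - T) (components (- K))"
proof
  fix F F' assume FF: "F \<in> components (- K)" "F' \<in> components (- K)" and eq: "F - T = F' - T"
  then have "F \<inter> F' \<noteq> {}"
    using face_minus_addition_nonempty by blast
  then show "F = F'"
    using components_nonoverlap FF by blast
qed

text \<open>\<open>F - T\<close> is open, has the closure of \<open>F\<close>, and misses
  \<open>K \<union> T\<close>, so on subsets of \<open>K \<union> T\<close> its frontier and the
  closure of \<open>F\<close> agree. The frontier of \<open>F\<close> itself would be wrong: a curve
  in \<open>T\<close> may run through the interior of \<open>F\<close>.\<close>

lemma subset_frontier_addition:
  assumes "F \<in> components (- K)" "P \<subseteq> K \<union> T"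
  shows "P \<subseteq> frontier (F - T) \<longleftrightarrow> P \<subseteq> closure F"
proof -
  have "open F"
    using assms closed_base by (auto intro: open_components)
  then have "frontier (F - T) = closure F - (F - T)"
    using closed_addition closure_diff_addition
    by (simp add: frontier_def interior_open open_Diff)
  then show ?thesis
    using assms in_components_subset[OF assms(1)] by auto
qed

text \<open>\<open>U\<close> stands for the open curve of an added edge and \<open>P\<close> for its
  image. Being connected and off \<open>K\<close>, \<open>U\<close> lies in one open face
  \<open>F\<close>, and any face whose closure contains \<open>P\<close> must meet \<open>F\<close>.
  So the dual edge is a loop.\<close>

lemma faces_at_added_curve:
  assumes P: "P \<subseteq> T" "P \<subseteq> closure U" and U: "U \<subseteq> P" "connected U" "U \<noteq> {}" "U \<inter> K = {}"
  obtains F where "F \<in> components (- K)" "U \<subseteq> F"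
    "{F' \<in> components (- (K \<union> T)). P \<subseteq> frontier F'} = {F - T}"
proof -
  obtain x where "x \<in> U" using U by auto
  then have x: "x \<in> - K" using U by auto
  define F where "F = connected_component_set (- K) x"
  have F: "F \<in> components (- K)"
    using x by (auto simp: F_def componentsI)
  have UF: "U \<subseteq> F"
    unfolding F_def using U \<open>x \<in> U\<close> by (intro connected_component_maximal) auto
  have "F' = F" if F': "F' \<in> components (- K)" "P \<subseteq> closure F'" for F'
  proof -
    have "open F"
      using F closed_base by (auto intro: open_components)
    moreover have "x \<in> F \<inter> closure F'"
      using \<open>x \<in> U\<close> U UF that by blast
    ultimately have "F \<inter> F' \<noteq> {}"
      using open_Int_closure_eq_empty by blast
    then show ?thesis
      using components_nonoverlap F F'(1) by blast
  qed
  moreover have "P \<subseteq> closure F"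
    using P closure_mono[OF UF] by blast
  moreover have frontier_iff: "P \<subseteq> frontier (F' - T) \<longleftrightarrow> P \<subseteq> closure F'"
    if "F' \<in> components (- K)" for F'
    using subset_frontier_addition[OF that] P by blast
  ultimately have "{F' \<in> components (- K). P \<subseteq> frontier (F' - T)} = {F}"
    using F by blast
  moreover have "{F' \<in> components (- (K \<union> T)). P \<subseteq> frontier F'} =
      (\<lambda>F. F - T) ` {F' \<in> components (- K). P \<subseteq> frontier (F' - T)}"
    unfolding components_addition by blast
  ultimately have "{F' \<in> components (- (K \<union> T)). P \<subseteq> frontier F'} = {F - T}"
    by (simp only: image_insert image_empty)
  then show ?thesis
    using that F UF by blast
qed

end

text \<open>The inverse of the parametrization would inject a nonempty open set continuously into
  the real line, against invariance of dimension.\<close>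

lemma interior_path_image_arc:
  fixes g :: "real \<Rightarrow> 'a::euclidean_space"
  assumes "arc g" "2 \<le> DIM('a)"
  shows "interior (path_image g) = {}"
proof (rule ccontr)
  assume ne: "interior (path_image g) \<noteq> {}"
  obtain h where h: "homeomorphism {0..1} (path_image g) g h"
    using homeomorphism_arc[OF assms(1)] .
  have "continuous_on (interior (path_image g)) h"
    using h interior_subset continuous_on_subset unfolding homeomorphism_def by blast
  moreover have "inj_on h (interior (path_image g))"
    using h interior_subset unfolding homeomorphism_def by (metis inj_onI subsetD)
  ultimately have "DIM('a) \<le> DIM(real)"
    using invariance_of_dimension[of "interior (path_image g)" h] ne by auto
  then show False using assms by simp
qed

lemma nonseparating_addition_empty: "closed K \<Longrightarrow> nonseparating_addition K {}"
  by unfold_locales auto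

text \<open>Janiszewski: if neither of two compact sets separates \<open>x\<close> from
  \<open>y\<close> and their intersection is connected, then their union does not separate them. An
  arc alone never separates the plane.\<close>

lemma nonseparating_addition_Un_arc:
  assumes "nonseparating_addition K T" "compact K" "compact T"
    and g: "arc g" "connected (path_image g \<inter> (K \<union> T))"
  shows "nonseparating_addition K (T \<union> path_image g)"
proof -
  interpret nonseparating_addition K T by fact
  show ?thesis
  proof
    show "closed (T \<union> path_image g)"
      using closed_addition g by (auto intro: closed_arc_image)
    show "interior (T \<union> path_image g) = {}"
      using interior_closed_Un_empty_interior[OF closed_addition interior_path_image_arc[OF g(1)]]
        interior_addition by simp
    fix x y assume x: "x \<notin> T \<union> path_image g" "y \<notin> T \<union> path_image g"
      and "connected_component (- K) x y"
    then have "connected_component (- (K \<union> T)) x y"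
      using connected_component_addition by blast
    moreover have "connected_component (- path_image g) x y"
      using x connected_arc_complement[OF g(1)]
      by (metis Compl_iff DIM_complex UnCI connected_iff_connected_component order_refl)
    moreover have "connected ((K \<union> T) \<inter> path_image g)"
      using g(2) by (simp add: Int_commute)
    ultimately have "connected_component (- ((K \<union> T) \<union> path_image g)) x y"
      using assms by (intro Janiszewski[of "K \<union> T"]) (simp_all add: compact_Un closed_arc_image)
    then show "connected_component (- (K \<union> (T \<union> path_image g))) x y"
      by (simp add: Un_assoc)
  qed (rule closed_base)
qed

subsection \<open>Theta curves\<close>

text \<open>A connected set properly containing \<open>R\<close> would have to cross the frontier of
  \<open>R\<close>, which lies in \<open>X\<close>. It shows that a side of a Jordan curve remains a
  component when the third arc is drawn on the other side.\<close>

lemma component_of_larger_set: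
  fixes R :: "'a::real_normed_vector set"
  assumes "connected R" "R \<noteq> {}" "R \<subseteq> - X" "frontier R \<subseteq> X"
  shows "R \<in> components (- X)"
  unfolding in_components_maximal
proof (intro conjI allI impI)
  fix D assume D: "D \<noteq> {} \<and> R \<subseteq> D \<and> D \<subseteq> - X \<and> connected D"
  show "D = R"
  proof (rule ccontr)
    assume "D \<noteq> R"
    then have "D \<inter> frontier R \<noteq> {}"
      using D assms by (intro connected_Int_frontier) auto
    then show False using D assms by auto
  qed
qed (use assms in auto)

locale theta_curve =
  fixes g\<^sub>1 g\<^sub>2 g\<^sub>3 :: "real \<Rightarrow> complex" and a b :: complex
  assumes arcs: "arc g\<^sub>1" "arc g\<^sub>2" "arc g\<^sub>3"
    and starts: "pathstart g\<^sub>1 = a" "pathstart g\<^sub>2 = a" "pathstart g\<^sub>3 = a"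
    and finishes: "pathfinish g\<^sub>1 = b" "pathfinish g\<^sub>2 = b" "pathfinish g\<^sub>3 = b"
    and meets: "path_image g\<^sub>1 \<inter> path_image g\<^sub>2 \<subseteq> {a, b}" "path_image g\<^sub>1 \<inter> path_image g\<^sub>3 \<subseteq> {a, b}"
      "path_image g\<^sub>2 \<inter> path_image g\<^sub>3 \<subseteq> {a, b}"
begin

abbreviation theta :: "complex set" where
  "theta \<equiv> path_image g\<^sub>1 \<union> path_image g\<^sub>2 \<union> path_image g\<^sub>3"

lemma ends_in: "{a, b} \<subseteq> path_image g\<^sub>1" "{a, b} \<subseteq> path_image g\<^sub>2" "{a, b} \<subseteq> path_image g\<^sub>3"
  using starts finishes pathstart_in_path_image[of g\<^sub>1] pathfinish_in_path_image[of g\<^sub>1]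
    pathstart_in_path_image[of g\<^sub>2] pathfinish_in_path_image[of g\<^sub>2]
    pathstart_in_path_image[of g\<^sub>3] pathfinish_in_path_image[of g\<^sub>3] by auto

text \<open>The face is the side of the Jordan curve that avoids the third arc.\<close>

lemma opposite_face:
  obtains R Q where "R \<in> components (- theta)" "frontier R = path_image g\<^sub>1 \<union> path_image g\<^sub>2"
    "connected Q" "R \<inter> Q = {}" "R \<union> Q = - (path_image g\<^sub>1 \<union> path_image g\<^sub>2)"
proof -
  let ?J = "path_image g\<^sub>1 \<union> path_image g\<^sub>2"
  define j where "j = g\<^sub>1 +++ reversepath g\<^sub>2"
  have j: "simple_path j" "pathfinish j = pathstart j" "path_image j = ?J"
    unfolding j_def using arcs starts finishes meets
    by (auto intro!: simple_path_join_loop simp: arc_reversepath path_image_join)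
  note J = Jordan_inside_outside[OF j(1,2), unfolded j(3)]
  define A where "A = path_image g\<^sub>3 - {a, b}"
  have conA: "connected A"
    unfolding A_def using connected_simple_path_endless[OF arc_imp_simple_path[OF arcs(3)]]
    by (simp add: starts finishes)
  have dis: "A \<inter> ?J = {}"
    using meets by (auto simp: A_def)
  have theta: "theta = ?J \<union> A"
    using ends_in by (auto simp: A_def)
  have "A \<subseteq> inside ?J \<or> A \<subseteq> outside ?J"
  proof (rule ccontr)
    assume "\<not> ?thesis"
    moreover have "A \<subseteq> inside ?J \<union> outside ?J"
      using J dis by blast
    moreover have "inside ?J \<inter> A = {} \<or> outside ?J \<inter> A = {}"
      using connectedD[OF conA, of "inside ?J" "outside ?J"] J calculation(2) by blast
    ultimately show False by blast
  qed
  then show ?thesis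
  proof
    assume A: "A \<subseteq> inside ?J"
    have "outside ?J \<in> components (- theta)"
      unfolding theta using J A by (intro component_of_larger_set) blast+
    then show ?thesis
      using that[of "outside ?J" "inside ?J"] J by blast
  next
    assume A: "A \<subseteq> outside ?J"
    have "inside ?J \<in> components (- theta)"
      unfolding theta using J A by (intro component_of_larger_set) blast+
    then show ?thesis
      using that[of "inside ?J" "outside ?J"] J by blast
  qed
qed

lemma theta_curve_132: "theta_curve g\<^sub>1 g\<^sub>3 g\<^sub>2 a b"
  and theta_curve_231: "theta_curve g\<^sub>2 g\<^sub>3 g\<^sub>1 a b"
  using arcs starts finishes meets by unfold_locales auto

lemma not_between:
  assumes "z \<in> path_image g\<^sub>1" "z \<notin> {a, b}"
  shows "z \<notin> path_image g\<^sub>2" "z \<notin> path_image g\<^sub>3"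
  using assms meets by auto

lemma proper_arc_points:
  obtains z where "z \<in> path_image g\<^sub>1" "z \<notin> path_image g\<^sub>2" "z \<notin> path_image g\<^sub>3"
proof -
  have "g\<^sub>1 (1/2) \<in> path_image g\<^sub>1" by (auto simp: path_image_def)
  moreover have "g\<^sub>1 (1/2) \<noteq> g\<^sub>1 0" "g\<^sub>1 (1/2) \<noteq> g\<^sub>1 1"
    using arcD[OF arcs(1), of "1/2" 0] arcD[OF arcs(1), of "1/2" 1] by auto
  then have "g\<^sub>1 (1/2) \<notin> {a, b}"
    using starts(1) finishes(1) by (auto simp: pathstart_def pathfinish_def)
  ultimately show ?thesis
    using that not_between by blast
qed

text \<open>Each pair of arcs yields one face, and the frontiers tell the three apart. That there is
  no fourth: a point \<open>x\<close> of such a face and a point \<open>y\<close> of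
  \<open>R23\<close> both lie on the far sides \<open>Q12\<close> and \<open>Q13\<close>, so neither
  Jordan curve through the first arc separates them. The two curves meet exactly in that arc, which
  is connected, so by Janiszewski their union, the whole theta curve, does not separate
  \<open>x\<close> from \<open>y\<close>.\<close>

lemma theta_faces:
  obtains R\<^sub>1\<^sub>2 R\<^sub>1\<^sub>3 R\<^sub>2\<^sub>3 where "components (- theta) = {R\<^sub>1\<^sub>2, R\<^sub>1\<^sub>3, R\<^sub>2\<^sub>3}"
    "R\<^sub>1\<^sub>2 \<noteq> R\<^sub>1\<^sub>3" "R\<^sub>1\<^sub>2 \<noteq> R\<^sub>2\<^sub>3" "R\<^sub>1\<^sub>3 \<noteq> R\<^sub>2\<^sub>3"
    "frontier R\<^sub>1\<^sub>2 = path_image g\<^sub>1 \<union> path_image g\<^sub>2"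
    "frontier R\<^sub>1\<^sub>3 = path_image g\<^sub>1 \<union> path_image g\<^sub>3"
    "frontier R\<^sub>2\<^sub>3 = path_image g\<^sub>2 \<union> path_image g\<^sub>3"
proof -
  let ?P = "path_image g\<^sub>1" and ?Q = "path_image g\<^sub>2" and ?R = "path_image g\<^sub>3"
  interpret B: theta_curve g\<^sub>1 g\<^sub>3 g\<^sub>2 a b by (rule theta_curve_132)
  interpret C: theta_curve g\<^sub>2 g\<^sub>3 g\<^sub>1 a b by (rule theta_curve_231)
  have th: "B.theta = theta" "C.theta = theta" by auto
  obtain R12 Q12 where R12: "R12 \<in> components (- theta)" "frontier R12 = ?P \<union> ?Q"
    "connected Q12" "R12 \<inter> Q12 = {}" "R12 \<union> Q12 = - (?P \<union> ?Q)"
    using opposite_face by metis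
  obtain R13 Q13 where R13: "R13 \<in> components (- theta)" "frontier R13 = ?P \<union> ?R"
    "connected Q13" "R13 \<inter> Q13 = {}" "R13 \<union> Q13 = - (?P \<union> ?R)"
    using B.opposite_face th by metis
  obtain R23 where R23: "R23 \<in> components (- theta)" "frontier R23 = ?Q \<union> ?R"
    using C.opposite_face th by metis
  obtain z1 where z1: "z1 \<in> ?P" "z1 \<notin> ?Q" "z1 \<notin> ?R"
    using proper_arc_points by metis
  obtain z2 where z2: "z2 \<in> ?Q" "z2 \<notin> ?R" "z2 \<notin> ?P"
    using C.proper_arc_points by metis
  have neq: "R12 \<noteq> R13" "R12 \<noteq> R23" "R13 \<noteq> R23"
    using R12(2) R13(2) R23(2) z1 z2 by blast+
  have "F \<in> {R12, R13, R23}" if F: "F \<in> components (- theta)" for F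
  proof (rule ccontr)
    assume nF: "F \<notin> {R12, R13, R23}"
    obtain x where x: "x \<in> F" using in_components_nonempty[OF F] by auto
    obtain y where y: "y \<in> R23" using in_components_nonempty[OF R23(1)] by auto
    have dis: "F \<inter> R12 = {}" "F \<inter> R13 = {}" "R23 \<inter> R12 = {}" "R23 \<inter> R13 = {}"
      using components_nonoverlap F R12(1) R13(1) R23(1) nF neq by blast+
    have sub: "F \<subseteq> - theta" "R23 \<subseteq> - theta"
      using in_components_subset F R23(1) by blast+
    have "x \<in> Q12" "x \<in> Q13" "y \<in> Q12" "y \<in> Q13"
      using x y sub dis R12(5) R13(5) by blast+
    then have "connected_component (- (?P \<union> ?Q)) x y" "connected_component (- (?P \<union> ?R)) x y"
      using R12(3,5) R13(3,5) unfolding connected_component_def by blast+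
    moreover have "(?P \<union> ?Q) \<inter> (?P \<union> ?R) = ?P"
      using meets(3) ends_in(1) by blast
    then have "connected ((?P \<union> ?Q) \<inter> (?P \<union> ?R))"
      using arcs(1) by (simp add: connected_arc_image)
    ultimately have "connected_component (- ((?P \<union> ?Q) \<union> (?P \<union> ?R))) x y"
      using arcs
      by (intro Janiszewski[of "?P \<union> ?Q" "?P \<union> ?R"]) (simp_all add: compact_Un closed_Un compact_arc_image closed_arc_image)
    then have "connected_component (- theta) x y"
      by (simp add: Un_ac)
    moreover have "F = connected_component_set (- theta) x" "R23 = connected_component_set (- theta) y"
      using F R23(1) x y by (metis components_iff connected_component_eq)+
    ultimately have "F = R23"
      by (metis connected_component_eq mem_Collect_eq)
    then show False using nF by simp
  qed
  then have "components (- theta) = {R12, R13, R23}"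
    using R12(1) R13(1) R23(1) by blast
  then show ?thesis
    using that neq R12(2) R13(2) R23(2) by blast
qed

end

subsection \<open>Edge curves of an embedding\<close>

definition drawing :: "('e \<Rightarrow> real \<Rightarrow> complex) \<Rightarrow> 'e set \<Rightarrow> complex set" where
  "drawing c S = (\<Union>e\<in>S. path_image (c e))"

lemma drawing_simps [simp]:
  "drawing c {} = {}"
  "drawing c (S \<union> S') = drawing c S \<union> drawing c S'"
  "drawing c (insert e S) = path_image (c e) \<union> drawing c S"
  by (auto simp: drawing_def)

lemma path_image_conv_open_curve:
  "path_image \<gamma> = open_curve \<gamma> \<union> {pathstart \<gamma>, pathfinish \<gamma>}"
proof -
  have "{0..1::real} = {0<..<1} \<union> {0, 1}" by auto
  then show ?thesis
    unfolding path_image_def open_curve_def pathstart_def pathfinish_def by (simp add: image_Un)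
qed

lemma open_curve_subset_path_image: "open_curve \<gamma> \<subseteq> path_image \<gamma>"
  unfolding path_image_conv_open_curve by blast

lemma open_curve_nonempty: "open_curve \<gamma> \<noteq> {}"
  by (simp add: open_curve_def)

lemma connected_open_curve: "path \<gamma> \<Longrightarrow> connected (open_curve \<gamma>)"
  unfolding open_curve_def path_def
  by (intro connected_continuous_image) (auto intro: continuous_on_subset)

lemma path_image_subset_closure_open_curve:
  assumes "path \<gamma>"
  shows "path_image \<gamma> \<subseteq> closure (open_curve \<gamma>)"
proof -
  have "\<gamma> ` closure {0<..<1} \<subseteq> closure (\<gamma> ` {0<..<1})"
    using assms by (intro image_closure_subset) (auto simp: path_def closure_subset)
  then show ?thesis
    by (simp add: path_image_def open_curve_def)
qed

locale embedded_multigraph =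
  fixes G :: "('v, 'e) multigraph" and p c
  assumes finite_multigraph: "finite_multigraph G" and embedding: "planar_embedding G p c"
begin

lemma inj_on_positions: "inj_on p (verts G)"
  using embedding by (simp add: planar_embedding_def)

lemma edge_curve:
  assumes "e \<in> edges G"
  shows simple_path_edge: "simple_path (c e)"
    and path_edge: "path (c e)"
    and ends_edge: "{pathstart (c e), pathfinish (c e)} = p ` ends G e"
    and open_curve_avoids_verts: "open_curve (c e) \<inter> p ` verts G = {}"
  using embedding assms by (auto simp: planar_embedding_def simple_path_imp_path)

lemma ends_subset_verts: "e \<in> edges G \<Longrightarrow> ends G e \<subseteq> verts G"
  using finite_multigraph by (simp add: finite_multigraph_def)

lemma open_curve_avoids_ends:
  assumes "e \<in> edges G" "e' \<in> edges G"
  shows "open_curve (c e) \<inter> p ` ends G e' = {}"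
proof -
  have "open_curve (c e) \<inter> p ` ends G e' \<subseteq> open_curve (c e) \<inter> p ` verts G"
    by (intro Int_mono image_mono order_refl ends_subset_verts assms)
  then show ?thesis
    using open_curve_avoids_verts[OF assms(1)] by simp
qed

lemma path_image_edge:
  "e \<in> edges G \<Longrightarrow> path_image (c e) = open_curve (c e) \<union> p ` ends G e"
  using path_image_conv_open_curve[of "c e"] ends_edge by simp

lemma path_image_edge_Int:
  assumes "e \<in> edges G" "e' \<in> edges G" "e \<noteq> e'"
  shows "path_image (c e) \<inter> path_image (c e') = p ` (ends G e \<inter> ends G e')"
proof -
  have "open_curve (c e) \<inter> open_curve (c e') = {}"
    using embedding[unfolded planar_embedding_def, THEN conjunct2, THEN conjunct2] assms by blast
  moreover have "p ` ends G e \<inter> p ` ends G e' = p ` (ends G e \<inter> ends G e')"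
    using inj_on_image_Int[OF inj_on_positions ends_subset_verts[OF assms(1)] ends_subset_verts[OF assms(2)]]
    by simp
  moreover have "open_curve (c e) \<inter> p ` ends G e' = {}"
    by (rule open_curve_avoids_ends[OF assms(1,2)])
  moreover have "p ` ends G e \<inter> open_curve (c e') = {}"
    using open_curve_avoids_ends[OF assms(2,1)] by (simp add: Int_commute)
  ultimately show ?thesis
    unfolding path_image_edge[OF assms(1)] path_image_edge[OF assms(2)]
    by (simp add: Int_Un_distrib Int_Un_distrib2)
qed

lemma path_image_edge_Int_drawing:
  assumes "e \<in> edges G" "S \<subseteq> edges G" "e \<notin> S"
  shows "path_image (c e) \<inter> drawing c S = p ` (ends G e \<inter> \<Union> (ends G ` S))"
proof -
  have "path_image (c e) \<inter> drawing c S = (\<Union>e'\<in>S. path_image (c e) \<inter> path_image (c e'))"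
    by (auto simp: drawing_def)
  also have "\<dots> = (\<Union>e'\<in>S. p ` (ends G e \<inter> ends G e'))"
    using assms by (intro SUP_cong refl path_image_edge_Int) auto
  also have "\<dots> = p ` (ends G e \<inter> \<Union> (ends G ` S))"
    by auto
  finally show ?thesis .
qed

lemma open_curve_Int_drawing:
  assumes "e \<in> edges G" "S \<subseteq> edges G" "e \<notin> S"
  shows "open_curve (c e) \<inter> drawing c S = {}"
proof -
  have "open_curve (c e) \<inter> drawing c S \<subseteq> path_image (c e) \<inter> drawing c S"
    using open_curve_subset_path_image by (rule Int_mono) simp
  also have "\<dots> \<subseteq> p ` verts G"
    unfolding path_image_edge_Int_drawing[OF assms]
    using ends_subset_verts[OF assms(1)] by (intro image_mono) blast
  finally show ?thesis
    using open_curve_avoids_verts[OF assms(1)] by blast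
qed

lemma arc_edge:
  assumes "e \<in> edges G" "card (ends G e) = 2"
  shows "arc (c e)"
proof -
  have card: "card (p ` ends G e) = 2"
    using assms inj_on_positions ends_subset_verts by (metis card_image inj_on_subset)
  have "pathstart (c e) \<noteq> pathfinish (c e)"
  proof
    assume "pathstart (c e) = pathfinish (c e)"
    then have "p ` ends G e = {pathfinish (c e)}"
      using ends_edge[OF assms(1)] by simp
    then show False using card by simp
  qed
  then show ?thesis
    using simple_path_edge[OF assms(1)] by (simp add: simple_path_imp_arc)
qed

text \<open>An embedding fixes only the unordered pair of end points, so the curve may have to be
  reversed before it can be joined to another one.\<close>

lemma oriented_edge:
  assumes "e \<in> edges G" "ends G e = {u, v}" "u \<noteq> v"
  obtains g where "arc g" "path_image g = path_image (c e)" "pathstart g = p u" "pathfinish g = p v"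
proof -
  have "arc (c e)"
    using arc_edge assms by simp
  moreover have "{pathstart (c e), pathfinish (c e)} = {p u, p v}"
    using ends_edge[OF assms(1)] assms(2) by simp
  then have "pathstart (c e) = p u \<and> pathfinish (c e) = p v \<or>
      pathstart (c e) = p v \<and> pathfinish (c e) = p u"
    by (simp add: doubleton_eq_iff)
  ultimately show ?thesis
    using that[of "c e"] that[of "reversepath (c e)"] by (auto simp: arc_reversepath)
qed

lemma compact_drawing: "S \<subseteq> edges G \<Longrightarrow> compact (drawing c S)"
  unfolding drawing_def using finite_multigraph path_edge
  by (intro compact_UN) (auto simp: finite_multigraph_def intro: finite_subset compact_path_image)

end

section \<open>Duals of embedded graphs with tree-like additions\<close>

text \<open>Tree-likeness is expressed through the edge numbering: each tail shares at most one
  vertex with all edges of smaller number. Its arc then meets the earlier drawing in at most one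
  point, which is the connectedness that Janiszewski asks for. By \<open>verts_covered\<close> the
  vertices already lie on the edge curves.\<close>

locale embedding_with_tails = embedded_multigraph G p c
  for G :: "('v, nat) multigraph" and p c +
  fixes k n :: nat
  assumes edges_eq: "edges G = {..<n}" and k_le: "k \<le> n"
    and verts_covered: "verts G = \<Union> (ends G ` edges G)"
    and tail_proper: "\<And>e. e \<in> {k..<n} \<Longrightarrow> card (ends G e) = 2"
    and tail_attached: "\<And>e. e \<in> {k..<n} \<Longrightarrow> \<exists>v. ends G e \<inter> \<Union> (ends G ` {..<e}) \<subseteq> {v}"
begin

abbreviation base :: "complex set" where "base \<equiv> drawing c {..<k}"
abbreviation tails :: "complex set" where "tails \<equiv> drawing c {k..<n}"

lemma nonseparating_tails: "nonseparating_addition base tails"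
proof -
  have "nonseparating_addition base (drawing c {k..<m})" if "k \<le> m" "m \<le> n" for m
    using that
  proof (induction m rule: dec_induct)
    case base
    have "compact (drawing c {..<k})"
      using k_le edges_eq by (intro compact_drawing) auto
    then show ?case
      by (simp add: nonseparating_addition_empty compact_imp_closed)
  next
    case (step m)
    have "k \<le> m" "m < n"
      using step.hyps step.prems by simp_all
    then have m: "m \<in> edges G" "m \<in> {k..<n}" "m \<notin> {..<m}"
      and sub: "{..<k} \<subseteq> edges G" "{k..<m} \<subseteq> edges G" "{..<m} \<subseteq> edges G"
      unfolding edges_eq by auto
    have un: "{..<k} \<union> {k..<m} = {..<m}" "{k..<Suc m} = insert m {k..<m}"
      using \<open>k \<le> m\<close> by auto
    obtain v where v: "ends G m \<inter> \<Union> (ends G ` {..<m}) \<subseteq> {v}"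
      using tail_attached[OF m(2)] by blast
    have "path_image (c m) \<inter> drawing c {..<m} \<subseteq> p ` {v}"
      unfolding path_image_edge_Int_drawing[OF m(1) sub(3) m(3)] using v by (rule image_mono)
    then have "path_image (c m) \<inter> drawing c {..<m} = {} \<or> path_image (c m) \<inter> drawing c {..<m} = {p v}"
      by (simp add: subset_singleton_iff)
    then have "connected (path_image (c m) \<inter> drawing c {..<m})"
      by (elim disjE) simp_all
    moreover have "drawing c {..<m} = drawing c {..<k} \<union> drawing c {k..<m}"
      by (simp only: un(1)[symmetric] drawing_simps)
    ultimately have "connected (path_image (c m) \<inter> (drawing c {..<k} \<union> drawing c {k..<m}))"
      by simp
    moreover have "nonseparating_addition base (drawing c {k..<m})"
      using step.IH step.prems by simp
    ultimately have "nonseparating_addition base (drawing c {k..<m} \<union> path_image (c m))"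
      using arc_edge[OF m(1) tail_proper[OF m(2)]]
      by (intro nonseparating_addition_Un_arc compact_drawing sub) simp_all
    then show "nonseparating_addition base (drawing c {k..<Suc m})"
      by (simp add: un(2) Un_commute)
  qed
  then show ?thesis using k_le by simp
qed

sublocale tail: nonseparating_addition base tails
  by (rule nonseparating_tails)

lemma drawing_eq: "p ` verts G \<union> (\<Union>e\<in>edges G. path_image (c e)) = base \<union> tails"
proof -
  have "p ` verts G \<subseteq> (\<Union>e\<in>edges G. path_image (c e))"
    unfolding verts_covered using path_image_edge by blast
  moreover have "{..<k} \<union> {k..<n} = edges G"
    unfolding edges_eq using k_le by auto
  then have "base \<union> tails = (\<Union>e\<in>edges G. path_image (c e))"
    by (simp only: drawing_def flip: UN_Un)
  ultimately show ?thesis by blast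
qed

lemma embedding_faces_eq: "embedding_faces G p c = (\<lambda>F. F - tails) ` components (- base)"
  unfolding embedding_faces_def drawing_eq by (rule tail.components_addition)

text \<open>The tails enter only through the renaming \<open>F \<mapsto> F - tails\<close>;
  incidence is decided by the base alone. Two drawings with the same base therefore agree on these
  edges.\<close>

lemma dual_base_edge:
  assumes "e < k"
  shows "ends (dual_graph G p c) e =
    (\<lambda>F. F - tails) ` {F \<in> components (- base). path_image (c e) \<subseteq> closure F}"
proof -
  have "path_image (c e) \<subseteq> base \<union> tails"
    using assms by (auto simp: drawing_def)
  then have "{F \<in> components (- base). path_image (c e) \<subseteq> closure F} =
      {F \<in> components (- base). path_image (c e) \<subseteq> frontier (F - tails)}"
    using tail.subset_frontier_addition by blast
  moreover have "ends (dual_graph G p c) e =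
      {F' \<in> (\<lambda>F. F - tails) ` components (- base). path_image (c e) \<subseteq> frontier F'}"
    by (simp add: dual_graph_def embedding_faces_eq)
  ultimately show ?thesis
    by (simp only:) blast
qed

lemma dual_tail_edge:
  assumes "e \<in> {k..<n}"
  obtains F where "F \<in> components (- base)" "open_curve (c e) \<subseteq> F"
    "ends (dual_graph G p c) e = {F - tails}"
proof -
  have e: "e \<in> edges G" and sub: "{..<k} \<subseteq> edges G" "e \<notin> {..<k}"
    using assms edges_eq k_le by auto
  obtain F where "F \<in> components (- base)" "open_curve (c e) \<subseteq> F"
    "{F' \<in> components (- (base \<union> tails)). path_image (c e) \<subseteq> frontier F'} = {F - tails}"
  proof (rule tail.faces_at_added_curve)
    show "path_image (c e) \<subseteq> tails"
      using assms by (auto simp: drawing_def)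
    show "open_curve (c e) \<inter> base = {}"
      by (rule open_curve_Int_drawing[OF e sub])
  qed (use path_edge[OF e] in \<open>simp_all add: path_image_subset_closure_open_curve
      open_curve_subset_path_image connected_open_curve open_curve_nonempty\<close>)
  then show ?thesis
    using that by (simp add: dual_graph_def embedding_faces_def drawing_eq)
qed

end

text \<open>With the same base, faces correspond by exchanging one set of removed tails for the
  other. A common point of the two curves of a tail lies in both base faces that contain them, so
  these faces coincide and the two loops sit at corresponding vertices.\<close>

lemma isomorphic_dual_graphs:
  assumes "embedding_with_tails G p c k n" "embedding_with_tails G' p' c' k n"
    and base: "\<And>e. e < k \<Longrightarrow> c' e = c e"
    and tails: "\<And>e. e \<in> {k..<n} \<Longrightarrow> open_curve (c e) \<inter> open_curve (c' e) \<noteq> {}"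
  shows "isomorphic_multigraphs (dual_graph G p c) (dual_graph G' p' c')"
proof -
  interpret G: embedding_with_tails G p c k n by fact
  interpret G': embedding_with_tails G' p' c' k n by fact
  let ?D = "dual_graph G p c" and ?D' = "dual_graph G' p' c'"
  define \<F> where "\<F> = components (- G.base)"
  have base_eq: "G'.base = G.base"
    using base by (auto simp: drawing_def)
  \<comment> \<open>\<open>h\<close> recovers the base face from the face left after removing the
    tails.\<close>
  define h where "h = inv_into \<F> (\<lambda>F. F - G.tails)"
  define f where "f X = h X - G'.tails" for X
  have h: "h (F - G.tails) = F" if "F \<in> \<F>" for F
    using that G.tail.inj_on_face_minus_addition unfolding h_def \<F>_def by (rule inv_into_f_f[rotated])
  have bij: "bij_betw f (verts ?D) (verts ?D')"
  proof (rule bij_betw_imageI)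
    have verts: "verts ?D = (\<lambda>F. F - G.tails) ` \<F>" "verts ?D' = (\<lambda>F. F - G'.tails) ` \<F>"
      by (simp_all add: dual_graph_def G.embedding_faces_eq G'.embedding_faces_eq \<F>_def base_eq)
    show "inj_on f (verts ?D)"
      using G'.tail.inj_on_face_minus_addition unfolding verts f_def
      by (auto simp: inj_on_def h \<F>_def[symmetric] base_eq)
    show "f ` verts ?D = verts ?D'"
      unfolding verts image_image f_def by (rule image_cong) (simp_all add: h)
  qed
  have "ends ?D' e = f ` ends ?D e" if "e \<in> edges ?D" for e
  proof (cases "e < k")
    case True
    show ?thesis
      unfolding G.dual_base_edge[OF True] G'.dual_base_edge[OF True] image_image f_def base_eq
        base[OF True] by (rule image_cong) (simp_all add: h \<F>_def)
  next
    case False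
    then have e: "e \<in> {k..<n}"
      using that by (simp add: dual_graph_def G.edges_eq)
    obtain F where F: "F \<in> components (- G.base)" "open_curve (c e) \<subseteq> F" "ends ?D e = {F - G.tails}"
      using G.dual_tail_edge[OF e] .
    obtain F' where F': "F' \<in> components (- G.base)" "open_curve (c' e) \<subseteq> F'"
      "ends ?D' e = {F' - G'.tails}"
      using G'.dual_tail_edge[OF e] unfolding base_eq .
    have "F \<inter> F' \<noteq> {}"
      using F(2) F'(2) tails[OF e] by blast
    then have "F' = F"
      using components_nonoverlap F(1) F'(1) by blast
    then show ?thesis
      using F F' h[of F] by (simp add: f_def \<F>_def)
  qed
  moreover have "bij_betw id (edges ?D) (edges ?D')"
    by (simp add: dual_graph_def G.edges_eq G'.edges_eq)
  ultimately show ?thesis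
    unfolding isomorphic_multigraphs_def using bij by (intro exI[of _ f] exI[of _ id]) simp
qed

subsection \<open>Theta graphs with three tails\<close>

text \<open>
  The poles of the theta graph are the vertices 0 and 1, and its three arcs run through 2, 3 and 4:
  for \<open>i < 3\<close>, the edges \<open>i\<close> and \<open>3 + i\<close> join \<open>2 + i\<close> to the poles 0 and 1.
\<close>

definition tailed_theta :: "nat \<Rightarrow> (nat \<Rightarrow> nat set) \<Rightarrow> (nat, nat) multigraph" where
  "tailed_theta n d = \<lparr>verts = {..<n}, edges = {..<9},
     ends = (\<lambda>e. if e < 6 then {e div 3, 2 + e mod 3} else d e)\<rparr>"

text \<open>The conditions of \<open>embedding_with_tails\<close> for the edges 6, 7, 8 over a theta
  graph with vertex set \<open>{..<5}\<close>. Excluding the poles 0 and 1 from \<open>d e\<close>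
  allows the tails to be drawn on the real axis.\<close>

definition tail_ends :: "nat \<Rightarrow> (nat \<Rightarrow> nat set) \<Rightarrow> bool" where
  "tail_ends n d \<longleftrightarrow> 5 \<le> n \<and> {5..<n} \<subseteq> d 6 \<union> d 7 \<union> d 8 \<and>
     (\<forall>e \<in> {6, 7, 8}. d e \<subseteq> {2..<n} \<and> card (d e) = 2 \<and>
        (\<exists>v. d e \<inter> ({..<5} \<union> \<Union> (d ` {6..<e})) \<subseteq> {v}))"

lemma tailed_theta_simps [simp]:
  "verts (tailed_theta n d) = {..<n}"
  "edges (tailed_theta n d) = {..<9}"
  "e < 6 \<Longrightarrow> ends (tailed_theta n d) e = {e div 3, 2 + e mod 3}"
  "6 \<le> e \<Longrightarrow> ends (tailed_theta n d) e = d e"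
  by (simp_all add: tailed_theta_def)

lemma less_6_cases:
  fixes e :: nat
  assumes "e < 6"
  obtains i where "i < 3" "e = i" | i where "i < 3" "e = 3 + i"
proof (cases "e < 3")
  case False
  then show ?thesis using that(2)[of "e - 3"] assms by simp
qed (use that in blast)

lemma tail_edges_eq: "{6..<9::nat} = {6, 7, 8}"
  by auto

lemma div_3_less_2:
  fixes e :: nat
  assumes "e < 6"
  shows "e div 3 < 2"
  using assms by simp

lemma Union_base_ends: "\<Union> (ends (tailed_theta n d) ` {..<6}) = {..<5}"
proof (intro equalityI subsetI)
  fix v assume "v \<in> \<Union> (ends (tailed_theta n d) ` {..<6})"
  then obtain e where e: "e < 6" "v = e div 3 \<or> v = 2 + e mod 3" by auto
  have "e mod 3 < 3" by simp
  then show "v \<in> {..<5}"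
    using e(2) div_3_less_2[OF e(1)] by auto
next
  fix v :: nat assume "v \<in> {..<5}"
  then have "v \<in> {0, 1, 2, 3, 4}" by auto
  then have "v \<in> ends (tailed_theta n d) 0 \<union> ends (tailed_theta n d) 1 \<union>
      ends (tailed_theta n d) 2 \<union> ends (tailed_theta n d) 3" by auto
  moreover have sub: "ends (tailed_theta n d) e \<subseteq> \<Union> (ends (tailed_theta n d) ` {..<6})" if "e < 6" for e
    using that by blast
  have "ends (tailed_theta n d) 0 \<union> ends (tailed_theta n d) 1 \<union>
      ends (tailed_theta n d) 2 \<union> ends (tailed_theta n d) 3 \<subseteq> \<Union> (ends (tailed_theta n d) ` {..<6})"
    by (intro Un_least) (rule sub, simp)+
  ultimately show "v \<in> \<Union> (ends (tailed_theta n d) ` {..<6})"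
    by blast
qed

lemma finite_multigraph_tailed_theta:
  assumes "tail_ends n d"
  shows "finite_multigraph (tailed_theta n d)"
proof -
  have "ends (tailed_theta n d) e \<subseteq> {..<n} \<and> card (ends (tailed_theta n d) e) = 2"
    if "e < 9" for e
  proof (cases "e < 6")
    case True
    have "ends (tailed_theta n d) e \<subseteq> {..<5}"
      using Union_base_ends[of n d] True by blast
    moreover have "5 \<le> n" using assms by (simp add: tail_ends_def)
    moreover have "e div 3 \<noteq> 2 + e mod 3"
      using div_3_less_2[OF True] by simp
    ultimately show ?thesis using True by auto
  next
    case False
    then have e: "e \<in> {6, 7, 8}" using that by auto
    then have "d e \<subseteq> {2..<n} \<and> card (d e) = 2"
      using assms unfolding tail_ends_def by blast
    then show ?thesis using False by auto
  qed
  then show ?thesis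
    by (simp add: finite_multigraph_def)
qed

lemma embedding_with_tails_theta:
  assumes d: "tail_ends n d" and emb: "planar_embedding (tailed_theta n d) p c"
  shows "embedding_with_tails (tailed_theta n d) p c 6 9"
proof
  show "finite_multigraph (tailed_theta n d)"
    by (rule finite_multigraph_tailed_theta[OF d])
  show "planar_embedding (tailed_theta n d) p c" by fact
  show "verts (tailed_theta n d) = \<Union> (ends (tailed_theta n d) ` edges (tailed_theta n d))"
  proof
    have "edges (tailed_theta n d) = {..<6} \<union> {6, 7, 8}" by auto
    then have "\<Union> (ends (tailed_theta n d) ` edges (tailed_theta n d)) = {..<5} \<union> (d 6 \<union> d 7 \<union> d 8)"
      by (simp only: image_Un Union_Un_distrib Union_base_ends) (simp add: Un_assoc)
    moreover have "{..<n} \<subseteq> {..<5} \<union> {5..<n}" by auto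
    ultimately show "verts (tailed_theta n d) \<subseteq> \<Union> (ends (tailed_theta n d) ` edges (tailed_theta n d))"
      using d unfolding tail_ends_def tailed_theta_simps by blast
  qed (use finite_multigraph_tailed_theta[OF d] in \<open>auto simp: finite_multigraph_def\<close>)
  fix e :: nat assume e: "e \<in> {6..<9}"
  then have e': "6 \<le> e" "e \<in> {6, 7, 8}" by auto
  have de: "card (d e) = 2" "\<exists>v. d e \<inter> ({..<5} \<union> \<Union> (d ` {6..<e})) \<subseteq> {v}"
    using d e'(2) unfolding tail_ends_def by blast+
  show "card (ends (tailed_theta n d) e) = 2"
    using de e' by simp
  have "{..<e} = {..<6} \<union> {6..<e}" using e'(1) by auto
  then have "\<Union> (ends (tailed_theta n d) ` {..<e}) = {..<5} \<union> \<Union> (d ` {6..<e})"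
    by (simp only: image_Un Union_Un_distrib Union_base_ends) simp
  with de(2) e'(1) show "\<exists>v. ends (tailed_theta n d) e \<inter> \<Union> (ends (tailed_theta n d) ` {..<e}) \<subseteq> {v}"
    by (simp only: tailed_theta_simps)
qed simp_all

section \<open>Faces in an arbitrary embedding of a tailed theta graph\<close>

locale tailed_theta_embedding = embedding_with_tails "tailed_theta n d" p c 6 9 for n d p c +
  assumes five_le: "5 \<le> n"
begin

definition theta_arc :: "nat \<Rightarrow> complex set" where
  "theta_arc i = path_image (c i) \<union> path_image (c (3 + i))"

lemma base_eq_theta_arcs: "base = theta_arc 0 \<union> theta_arc 1 \<union> theta_arc 2"
proof -
  have "{..<6::nat} = {0, 3, 1, 4, 2, 5}" by auto
  then show ?thesis
    by (simp add: theta_arc_def Un_ac numeral_eq_Suc)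
qed

lemma p_eq_iff: "u < 5 \<Longrightarrow> v < 5 \<Longrightarrow> p u = p v \<longleftrightarrow> u = v"
  using inj_on_positions five_le by (simp add: inj_on_eq_iff)

lemma theta_arc_Int:
  assumes "i < 3" "j < 3" "i \<noteq> j"
  shows "theta_arc i \<inter> theta_arc j \<subseteq> {p 0, p 1}"
proof -
  have "path_image (c i) \<inter> path_image (c j) = p ` ({0, 2 + i} \<inter> {0, 2 + j})"
    "path_image (c i) \<inter> path_image (c (3 + j)) = p ` ({0, 2 + i} \<inter> {1, 2 + j})"
    "path_image (c (3 + i)) \<inter> path_image (c j) = p ` ({1, 2 + i} \<inter> {0, 2 + j})"
    "path_image (c (3 + i)) \<inter> path_image (c (3 + j)) = p ` ({1, 2 + i} \<inter> {1, 2 + j})"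
    using assms path_image_edge_Int[of i j] path_image_edge_Int[of i "3 + j"]
      path_image_edge_Int[of "3 + i" j] path_image_edge_Int[of "3 + i" "3 + j"] by simp_all
  then show ?thesis
    using assms by (auto simp: theta_arc_def Int_Un_distrib Int_Un_distrib2)
qed

lemma oriented_theta_arc:
  assumes "i < 3"
  obtains g where "arc g" "path_image g = theta_arc i" "pathstart g = p 0" "pathfinish g = p 1"
proof -
  obtain g where g: "arc g" "path_image g = path_image (c i)" "pathstart g = p 0" "pathfinish g = p (2 + i)"
    using oriented_edge[of i 0 "2 + i"] assms by auto
  obtain h where h: "arc h" "path_image h = path_image (c (3 + i))"
    "pathstart h = p (2 + i)" "pathfinish h = p 1"
    using oriented_edge[of "3 + i" "2 + i" 1] assms by (auto simp: insert_commute)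
  have "path_image (c i) \<inter> path_image (c (3 + i)) = p ` ({0, 2 + i} \<inter> {1, 2 + i})"
    using assms path_image_edge_Int[of i "3 + i"] by simp
  then have "path_image g \<inter> path_image h \<subseteq> {pathstart h}"
    using g(2) h(2,3) by auto
  then have "arc (g +++ h)"
    using g h by (intro arc_join) auto
  moreover have "path_image (g +++ h) = theta_arc i"
    using g h by (simp add: path_image_join theta_arc_def)
  ultimately show ?thesis
    using that[of "g +++ h"] g h by simp
qed

lemma base_faces:
  obtains R :: "nat \<Rightarrow> complex set" where "components (- base) = R ` {..<3}" "inj_on R {..<3}"
    "\<forall>i<3. frontier (R i) = \<Union> (theta_arc ` ({..<3} - {i}))"
proof -
  obtain g0 where g0: "arc g0" "path_image g0 = theta_arc 0" "pathstart g0 = p 0" "pathfinish g0 = p 1"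
    using oriented_theta_arc[of 0] by auto
  obtain g1 where g1: "arc g1" "path_image g1 = theta_arc 1" "pathstart g1 = p 0" "pathfinish g1 = p 1"
    using oriented_theta_arc[of 1] by auto
  obtain g2 where g2: "arc g2" "path_image g2 = theta_arc 2" "pathstart g2 = p 0" "pathfinish g2 = p 1"
    using oriented_theta_arc[of 2] by auto
  interpret theta_curve g0 g1 g2 "p 0" "p 1"
    using g0 g1 g2 theta_arc_Int[of 0 1] theta_arc_Int[of 0 2] theta_arc_Int[of 1 2]
    by unfold_locales simp_all
  obtain R01 R02 R12 where R: "components (- theta) = {R01, R02, R12}"
    "R01 \<noteq> R02" "R01 \<noteq> R12" "R02 \<noteq> R12"
    "frontier R01 = theta_arc 0 \<union> theta_arc 1"
    "frontier R02 = theta_arc 0 \<union> theta_arc 2"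
    "frontier R12 = theta_arc 1 \<union> theta_arc 2"
    using theta_faces g0(2) g1(2) g2(2) by metis
  \<comment> \<open>Faces are indexed by the arc that their frontier omits.\<close>
  define R where "R i = (if i = 0 then R12 else if i = 1 then R02 else R01)" for i :: nat
  have three: "{..<3::nat} = {0, 1, 2}" by auto
  have "theta = base"
    using g0 g1 g2 base_eq_theta_arcs by simp
  then have "components (- base) = R ` {..<3}"
    unfolding three R_def using R(1) by auto
  moreover have "inj_on R {..<3}"
    unfolding three R_def using R(2-4) by auto
  moreover have "frontier (R i) = \<Union> (theta_arc ` ({..<3} - {i}))" if "i < 3" for i
  proof -
    have "i \<in> {0, 1, 2}" using that by auto
    moreover have "{0, 1, 2} - {0} = {1, 2::nat}" "{0, 1, 2} - {1} = {0, 2::nat}"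
      "{0, 1, 2} - {2} = {0, 1::nat}" by auto
    ultimately show ?thesis
      unfolding three R_def using R(5-7) by (elim insertE) auto
  qed
  ultimately show ?thesis
    using that[of R] by simp
qed

text \<open>An edge on arc \<open>j\<close> borders the two faces \<open>R i\<close> with
  \<open>i \<noteq> j\<close>. Hence only tails can become loops of the dual, which lets an
  isomorphism be traced on the tails.\<close>

lemma card_dual_base_edge:
  assumes "e < 6"
  shows "card (ends (dual_graph (tailed_theta n d) p c) e) \<noteq> 1"
proof
  let ?E = "ends (dual_graph (tailed_theta n d) p c) e"
  assume "card ?E = 1"
  then obtain X where X: "?E = {X}"
    by (auto simp: card_1_singleton_iff)
  obtain R :: "nat \<Rightarrow> complex set" where R: "components (- base) = R ` {..<3}" "inj_on R {..<3}"
    "\<forall>i<3. frontier (R i) = \<Union> (theta_arc ` ({..<3} - {i}))"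
    using base_faces by metis
  obtain j where j: "j < 3" "path_image (c e) \<subseteq> theta_arc j"
    using less_6_cases[OF assms] by (metis theta_arc_def Un_upper1 Un_upper2)
  have "R i - tails = X" if "i < 3" "i \<noteq> j" for i
  proof -
    have "path_image (c e) \<subseteq> frontier (R i)"
      using R(3) that(1) j that(2) by blast
    then have "path_image (c e) \<subseteq> closure (R i)"
      by (auto simp: frontier_def)
    then have "R i - tails \<in> ?E"
      unfolding dual_base_edge[OF assms] R(1) using that(1) by blast
    then show ?thesis using X by simp
  qed
  moreover obtain i i' where "i < 3" "i' < 3" "i \<noteq> j" "i' \<noteq> j" "i \<noteq> i'"
  proof -
    have "j = 0 \<or> j = 1 \<or> j = 2" using j(1) by auto
    then show ?thesis using that[of 1 2] that[of 0 2] that[of 0 1] by auto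
  qed
  moreover from this have "R i \<in> components (- base)" "R i' \<in> components (- base)" "R i \<noteq> R i'"
    using R(1,2) by (auto simp: inj_on_eq_iff)
  ultimately show False
    using tail.inj_on_face_minus_addition by (metis inj_on_eq_iff)
qed

text \<open>The face \<open>R j\<close> is bounded by the two arcs other than \<open>j\<close>, and
  these meet arc \<open>j\<close> at most in the poles, so \<open>2 + j\<close> is not on its
  boundary.\<close>

lemma middle_vertices_not_cofacial:
  assumes "F \<in> components (- base)"
  shows "\<not> p ` {2, 3, 4} \<subseteq> closure F"
proof
  assume cl: "p ` {2, 3, 4} \<subseteq> closure F"
  obtain R :: "nat \<Rightarrow> complex set" where R: "components (- base) = R ` {..<3}"
    "\<forall>i<3. frontier (R i) = \<Union> (theta_arc ` ({..<3} - {i}))"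
    using base_faces by metis
  obtain j where j: "j < 3" "F = R j"
    using assms R(1) by auto
  have in_arc: "p (2 + j) \<in> theta_arc j"
    using path_image_edge[of j] j by (auto simp: theta_arc_def)
  have "2 + j \<in> {2, 3, 4}" using j by auto
  then have "p (2 + j) \<in> closure F" using cl by blast
  moreover have "p (2 + j) \<in> base"
    using in_arc j base_eq_theta_arcs less_Suc_eq numeral_3_eq_3 numeral_2_eq_2 by auto
  then have "p (2 + j) \<notin> F"
    using in_components_subset[OF assms] by blast
  ultimately have "p (2 + j) \<in> frontier F"
    using closure_Un_frontier by blast
  then obtain i where i: "i < 3" "i \<noteq> j" "p (2 + j) \<in> theta_arc i"
    using R(2) j(1) j(2) by auto
  then have "p (2 + j) \<in> {p 0, p 1}"
    using theta_arc_Int[OF i(1) j(1) i(2)] in_arc by blast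
  then show False
    using p_eq_iff j by auto
qed

end

lemma tailed_theta_embeddingI:
  assumes "tail_ends n d" "planar_embedding (tailed_theta n d) p c"
  shows "tailed_theta_embedding n d p c"
proof -
  interpret embedding_with_tails "tailed_theta n d" p c 6 9
    using assms by (rule embedding_with_tails_theta)
  show ?thesis
    by unfold_locales (use assms in \<open>simp add: tail_ends_def\<close>)
qed

subsection \<open>Straight-line drawings\<close>

text \<open>
  The poles are drawn at \<open>\<plusminus>\<i>\<close>, all other vertices on the real axis with the middle vertices at
  \<open>-1\<close>, \<open>0\<close>, \<open>1\<close>, so that the tails become disjoint intervals.
\<close>

definition straight_pos :: "(nat \<Rightarrow> real) \<Rightarrow> nat \<Rightarrow> complex" where
  "straight_pos r v = (if v = 0 then \<i> else if v = 1 then - \<i> else of_real (r v))"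

definition straight_curve :: "(nat \<Rightarrow> real) \<Rightarrow> (nat \<Rightarrow> real) \<Rightarrow> nat \<Rightarrow> real \<Rightarrow> complex" where
  "straight_curve s t e =
     (if e < 6 then linepath (of_real (real (e mod 3) - 1)) (if e < 3 then \<i> else - \<i>)
      else linepath (of_real (s e)) (of_real (t e)))"

text \<open>The sign of the imaginary part along a base edge: edges 0, 1, 2 run up to the pole at
  \<open>\<i>\<close>, edges 3, 4, 5 down to the other one.\<close>

definition side :: "nat \<Rightarrow> real" where
  "side e = (if e < 3 then 1 else -1)"

text \<open>\<open>side e * Im z\<close> is the parameter of \<open>z\<close> on the segment. A
  point thus determines its parameter, and through its real part also the middle vertex of its
  edge.\<close>

lemma open_curve_straight_base:
  assumes "e < 6" "z \<in> open_curve (straight_curve s t e)"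
  shows "0 < side e * Im z" "side e * Im z < 1"
    "Re z = (1 - side e * Im z) * (real (e mod 3) - 1)"
proof -
  define m where "m = real (e mod 3) - 1"
  have "straight_curve s t e = linepath (of_real m) (of_real (side e) * \<i>)"
    using assms(1) by (simp add: straight_curve_def m_def side_def)
  then obtain x where x: "0 < x" "x < 1" "z = linepath (of_real m) (of_real (side e) * \<i>) x"
    using assms(2) by (auto simp: open_curve_def)
  have "side e * side e = 1"
    by (simp add: side_def)
  then have im: "side e * Im z = x"
    by (simp add: x(3) linepath_def mult.left_commute)
  have "Re z = (1 - x) * m"
    by (simp add: x(3) linepath_def)
  then show "0 < side e * Im z" "side e * Im z < 1"
    "Re z = (1 - side e * Im z) * (real (e mod 3) - 1)"
    using x im by (simp_all add: m_def)
qed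

lemma open_curve_linepath_of_real:
  assumes "a < b"
  shows "open_curve (linepath (of_real a) (of_real b) :: real \<Rightarrow> complex) = of_real ` {a<..<b}"
proof (intro equalityI subsetI)
  fix z :: complex assume "z \<in> open_curve (linepath (of_real a) (of_real b))"
  then obtain x where x: "0 < x" "x < 1" "z = linepath (of_real a) (of_real b) x"
    by (auto simp: open_curve_def)
  have "z = of_real (a + x * (b - a))"
    by (simp add: x(3) linepath_def scaleR_conv_of_real algebra_simps)
  moreover have "0 < x * (b - a)" "x * (b - a) < 1 * (b - a)"
    using x assms by (auto intro: mult_strict_right_mono)
  ultimately show "z \<in> of_real ` {a<..<b}"
    by (intro image_eqI[where x = "a + x * (b - a)"]) auto
next
  fix z :: complex assume "z \<in> of_real ` {a<..<b}"
  then obtain u where u: "a < u" "u < b" "z = of_real u" by auto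
  define x where "x = (u - a) / (b - a)"
  have x: "x \<in> {0<..<1}"
    using u assms by (simp add: x_def field_simps)
  have "u = a + x * (b - a)"
    using assms by (simp add: x_def)
  then have "z = of_real (a + x * (b - a))"
    using u(3) by simp
  then have "z = linepath (of_real a) (of_real b) x"
    by (simp add: linepath_def scaleR_conv_of_real algebra_simps)
  then show "z \<in> open_curve (linepath (of_real a) (of_real b))"
    using x by (auto simp: open_curve_def)
qed

text \<open>Open base segments have imaginary part strictly between 0 and 1 in absolute value, while
  vertices have -1, 0 or 1 and tails have 0. What remains is to separate base segments from one
  another and to compare intervals on the real axis.\<close>

lemma planar_embedding_straight:
  assumes d: "tail_ends n d"
    and r: "r 2 = -1" "r 3 = 0" "r 4 = 1" "inj_on r {2..<n}"
    and tail: "\<And>e. e \<in> {6, 7, 8} \<Longrightarrow>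
      s e < t e \<and> r ` d e = {s e, t e} \<and> (\<forall>v \<in> {2..<n}. r v \<le> s e \<or> t e \<le> r v)"
    and disjoint: "\<And>e e'. \<lbrakk>e \<in> {6, 7, 8}; e' \<in> {6, 7, 8}; e < e'\<rbrakk> \<Longrightarrow>
      t e \<le> s e' \<or> t e' \<le> s e"
  shows "planar_embedding (tailed_theta n d) (straight_pos r) (straight_curve s t)"
proof -
  let ?G = "tailed_theta n d" and ?p = "straight_pos r" and ?c = "straight_curve s t"
  have mid: "r (2 + j) = real j - 1" if "j < 3" for j
  proof -
    have "r (2 + 0) = real 0 - 1" "r (2 + 1) = real 1 - 1" "r (2 + 2) = real 2 - 1"
      using r(1-3) by simp_all
    moreover have "j = 0 \<or> j = 1 \<or> j = 2" using that by auto
    ultimately show ?thesis by metis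
  qed
  have open_tail: "open_curve (?c e) = of_real ` {s e<..<t e}" if "e \<in> {6, 7, 8}" for e
    using that tail[OF that] open_curve_linepath_of_real[of "s e" "t e"]
    by (auto simp: straight_curve_def)
  have inj: "inj_on ?p (verts ?G)"
  proof (rule inj_onI)
    fix u v assume "u \<in> verts ?G" "v \<in> verts ?G" and eq: "?p u = ?p v"
    moreover have "w = 0 \<or> w = 1 \<or> w \<in> {2..<n}" if "w < n" for w
      using that by auto
    ultimately have "u = 0 \<or> u = 1 \<or> u \<in> {2..<n}" "v = 0 \<or> v = 1 \<or> v \<in> {2..<n}"
      by auto
    then show "u = v"
      using eq r(4) by (auto simp: straight_pos_def complex_eq_iff inj_on_def split: if_splits)
  qed
  have pos: "z = \<i> \<or> z = - \<i> \<or> z \<in> of_real ` r ` {2..<n}" if z: "z \<in> ?p ` verts ?G" for z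
  proof -
    obtain v where v: "v < n" "z = ?p v" using z by auto
    then show ?thesis by (cases "v < 2") (auto simp: straight_pos_def)
  qed
  have edge: "simple_path (?c e) \<and> {pathstart (?c e), pathfinish (?c e)} = ?p ` ends ?G e \<and>
      open_curve (?c e) \<inter> ?p ` verts ?G = {}" if "e \<in> edges ?G" for e
  proof (cases "e < 6")
    case True
    define m where "m = real (e mod 3) - 1"
    define w where "w = (if e < 3 then \<i> else - \<i>)"
    have curve: "?c e = linepath (of_real m) w"
      using True unfolding straight_curve_def m_def w_def by (rule if_P)
    have "of_real m \<noteq> w"
      by (simp add: w_def complex_eq_iff)
    then have "simple_path (?c e)"
      unfolding curve by (rule simple_path_linepath)
    moreover have "?p (2 + e mod 3) = of_real m"
      using mid[of "e mod 3"] by (simp add: straight_pos_def m_def)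
    moreover have "?p (e div 3) = w"
    proof -
      have "e div 3 = (if e < 3 then 0 else 1)" using True by auto
      then show ?thesis by (simp add: straight_pos_def w_def)
    qed
    then have "?p ` ends ?G e = {w, ?p (2 + e mod 3)}"
      using True by simp
    ultimately have "simple_path (?c e) \<and> {pathstart (?c e), pathfinish (?c e)} = ?p ` ends ?G e"
      unfolding curve by (simp only: pathstart_linepath pathfinish_linepath insert_commute)
    moreover have "open_curve (?c e) \<inter> ?p ` verts ?G = {}"
    proof (rule ccontr)
      assume "\<not> ?thesis"
      then obtain z where z: "z \<in> open_curve (?c e)" "z \<in> ?p ` verts ?G" by blast
      have "Im z = 1 \<or> Im z = -1 \<or> Im z = 0"
        using pos[OF z(2)] by auto
      then show False
        using open_curve_straight_base(1,2)[OF True z(1)] by (auto simp: side_def split: if_splits)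
    qed
    ultimately show ?thesis by blast
  next
    case False
    then have e: "e \<in> {6, 7, 8}" using that by auto
    note te = tail[OF e]
    have "d e \<subseteq> {2..<n}" using d e unfolding tail_ends_def by blast
    then have "?p ` d e = of_real ` r ` d e"
      unfolding image_image by (intro image_cong) (auto simp: straight_pos_def)
    then have "?p ` ends ?G e = {of_real (s e), of_real (t e)}"
      using te False by simp
    moreover have "open_curve (?c e) \<inter> ?p ` verts ?G = {}"
    proof (rule ccontr)
      assume "\<not> ?thesis"
      then obtain z where z: "z \<in> of_real ` {s e<..<t e}" "z \<in> ?p ` verts ?G"
        unfolding open_tail[OF e] by blast
      then have "z \<in> of_real ` r ` {2..<n}"
        using pos[OF z(2)] by (auto simp: complex_eq_iff)
      then obtain v where "v \<in> {2..<n}" "s e < r v" "r v < t e"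
        using z(1) by auto
      then show False using te by force
    qed
    ultimately show ?thesis
      using te False by (simp add: straight_curve_def simple_path_linepath)
  qed
  have "open_curve (?c e) \<inter> open_curve (?c e') = {}"
    if e: "e \<in> edges ?G" "e' \<in> edges ?G" "e \<noteq> e'" for e e'
  proof (rule ccontr)
    assume "\<not> ?thesis"
    then obtain z where z: "z \<in> open_curve (?c e)" "z \<in> open_curve (?c e')" by blast
    have tails: "e \<in> {6, 7, 8}" if "\<not> e < 6" "e \<in> edges ?G" for e
      using that by auto
    have real: "Im z = 0" if "\<not> e < 6" "e \<in> edges ?G" "z \<in> open_curve (?c e)" for e
      using open_tail[OF tails[OF that(1,2)]] that(3) by auto
    have nonreal: "Im z \<noteq> 0" if "e < 6" "z \<in> open_curve (?c e)" for e
      using open_curve_straight_base(1)[OF that] by auto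
    show False
    proof (cases "e < 6")
      case True
      then have "e' < 6" using real nonreal z e by blast
      note z' = open_curve_straight_base[OF True z(1)] open_curve_straight_base[OF \<open>e' < 6\<close> z(2)]
      have side: "side e = side e'"
        using z'(1,4) by (auto simp: side_def split: if_splits)
      \<comment> \<open>Both segments have \<open>z\<close> at the same height below 1, so the
        positive factor in the formula for \<open>Re z\<close> cancels.\<close>
      then have "real (e mod 3) = real (e' mod 3)"
        using z'(2,3,6) by auto
      moreover have "e div 3 = e' div 3"
      proof -
        have "e div 3 = (if e < 3 then 0 else 1)" "e' div 3 = (if e' < 3 then 0 else 1)"
          using True \<open>e' < 6\<close> by auto
        then show ?thesis using side by (simp add: side_def split: if_splits)
      qed
      ultimately have "e = e'"
        by (metis div_mult_mod_eq of_nat_eq_iff)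
      then show False using e by simp
    next
      case False
      then have "\<not> e' < 6" using real nonreal z e by blast
      then have "z \<in> of_real ` {s e<..<t e}" "z \<in> of_real ` {s e'<..<t e'}"
        using z open_tail tails e False by blast+
      then obtain u where u: "s e < u" "u < t e" "s e' < u" "u < t e'" by auto
      have "e < e' \<or> e' < e" using e(3) by auto
      then have "t e \<le> s e' \<or> t e' \<le> s e"
        using disjoint[OF tails[OF False e(1)] tails[OF \<open>\<not> e' < 6\<close> e(2)]]
          disjoint[OF tails[OF \<open>\<not> e' < 6\<close> e(2)] tails[OF False e(1)]] by blast
      then show False using u by linarith
    qed
  qed
  then show ?thesis
    unfolding planar_embedding_def using inj edge by (intro conjI ballI impI) simp_all
qed

lemma planar_graph_tailed_theta:
  assumes "tail_ends n d" "planar_embedding (tailed_theta n d) p c"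
  shows "planar_graph (tailed_theta n d)"
  unfolding planar_graph_def using finite_multigraph_tailed_theta[OF assms(1)] assms(2)
  by (intro conjI exI[of _ p] exI[of _ c])

lemma isomorphic_straight_duals:
  assumes "tail_ends n d" "tail_ends n' d'"
    and "planar_embedding (tailed_theta n d) (straight_pos r) (straight_curve s t)"
    and "planar_embedding (tailed_theta n' d') (straight_pos r') (straight_curve s' t')"
    and overlap: "\<And>e. e \<in> {6, 7, 8} \<Longrightarrow> max (s e) (s' e) < min (t e) (t' e)"
  shows "isomorphic_multigraphs (dual_graph (tailed_theta n d) (straight_pos r) (straight_curve s t))
    (dual_graph (tailed_theta n' d') (straight_pos r') (straight_curve s' t'))"
proof (rule isomorphic_dual_graphs)
  show "embedding_with_tails (tailed_theta n d) (straight_pos r) (straight_curve s t) 6 9"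
    "embedding_with_tails (tailed_theta n' d') (straight_pos r') (straight_curve s' t') 6 9"
    using assms by (simp_all add: embedding_with_tails_theta)
  show "straight_curve s' t' e = straight_curve s t e" if "e < 6" for e
    using that by (simp add: straight_curve_def)
  fix e :: nat assume "e \<in> {6..<9}"
  then have e: "e \<in> {6, 7, 8}" "\<not> e < 6" by auto
  obtain u where u: "max (s e) (s' e) < u" "u < min (t e) (t' e)"
    using overlap[OF e(1)] dense by blast
  then have "of_real u \<in> open_curve (straight_curve s t e)"
    "of_real u \<in> open_curve (straight_curve s' t' e)"
    using e(2) by (simp_all add: straight_curve_def open_curve_linepath_of_real)
  then show "open_curve (straight_curve s t e) \<inter> open_curve (straight_curve s' t' e) \<noteq> {}"
    by blast
qed

subsection \<open>The three graphs\<close>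

text \<open>For the edges 6, 7, 8 the three formulas give the pairs 2-5, 3-6, 4-7 (pendant edges),
  5-6, 7-8, 9-10 (matching) and 5-6, 6-7, 7-8 (path). This accounts for the vertex numbers 8, 11 and
  9.\<close>

definition pendant_ends :: "nat \<Rightarrow> nat set" where "pendant_ends e = {e - 4, e - 1}"
definition matching_ends :: "nat \<Rightarrow> nat set" where "matching_ends e = {2 * e - 7, 2 * e - 6}"
definition path_ends :: "nat \<Rightarrow> nat set" where "path_ends e = {e - 1, e}"

abbreviation "theta_pendants \<equiv> tailed_theta 8 pendant_ends"
abbreviation "theta_matching \<equiv> tailed_theta 11 matching_ends"
abbreviation "theta_path \<equiv> tailed_theta 9 path_ends"

lemma tail_ends_pendant: "tail_ends 8 pendant_ends"
proof -
  have "{5..<8::nat} = {5, 6, 7}" "{6..<7::nat} = {6}" "{6..<8::nat} = {6, 7}" by auto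
  then show ?thesis
    by (auto simp: tail_ends_def pendant_ends_def)
qed

lemma tail_ends_matching: "tail_ends 11 matching_ends"
proof -
  have "{5..<11::nat} = {5, 6, 7, 8, 9, 10}" "{6..<7::nat} = {6}" "{6..<8::nat} = {6, 7}" by auto
  then show ?thesis
    by (auto simp: tail_ends_def matching_ends_def)
qed

lemma tail_ends_path: "tail_ends 9 path_ends"
proof -
  have "{5..<9::nat} = {5, 6, 7, 8}" "{6..<7::nat} = {6}" "{6..<8::nat} = {6, 7}" by auto
  then show ?thesis
    by (auto simp: tail_ends_def path_ends_def)
qed

text \<open>The pendant edges occupy \<open>[-1, -1/2]\<close>, \<open>[0, 1/2]\<close>,
  \<open>[1, 3/2]\<close>; the near matching takes the right halves, which overlap them but avoid
  the middle vertices. The path occupies \<open>[6, 7]\<close>, \<open>[7, 8]\<close>,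
  \<open>[8, 9]\<close>, and the far matching takes the left halves.\<close>

definition pendant_pos :: "nat \<Rightarrow> real" where
  "pendant_pos v = (if v < 5 then real v - 3 else real v - 11 / 2)"
definition near_matching_pos :: "nat \<Rightarrow> real" where
  "near_matching_pos v = (if v < 5 then real v - 3 else if odd v then real v / 2 - 13 / 4 else real v / 2 - 7 / 2)"
definition far_matching_pos :: "nat \<Rightarrow> real" where
  "far_matching_pos v = (if v < 5 then real v - 3 else real v / 2 + 7 / 2)"
definition path_pos :: "nat \<Rightarrow> real" where
  "path_pos v = (if v < 5 then real v - 3 else real v + 1)"

lemma planar_pendants:
  "planar_embedding theta_pendants (straight_pos pendant_pos)
    (straight_curve (\<lambda>e. real e - 7) (\<lambda>e. real e - 13 / 2))"
proof -
  have verts: "{2..<8::nat} = {2, 3, 4, 5, 6, 7}" by auto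
  show ?thesis
    by (rule planar_embedding_straight[OF tail_ends_pendant]; (elim insertE emptyE)?)
      (simp_all add: verts pendant_pos_def pendant_ends_def doubleton_eq_iff)
qed

lemma planar_near_matching:
  "planar_embedding theta_matching (straight_pos near_matching_pos)
    (straight_curve (\<lambda>e. real e - 27 / 4) (\<lambda>e. real e - 13 / 2))"
proof -
  have verts: "{2..<11::nat} = {2, 3, 4, 5, 6, 7, 8, 9, 10}" by auto
  show ?thesis
    by (rule planar_embedding_straight[OF tail_ends_matching]; (elim insertE emptyE)?)
      (simp_all add: verts near_matching_pos_def matching_ends_def doubleton_eq_iff)
qed

lemma planar_far_matching:
  "planar_embedding theta_matching (straight_pos far_matching_pos)
    (straight_curve (\<lambda>e. real e) (\<lambda>e. real e + 1 / 2))"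
proof -
  have verts: "{2..<11::nat} = {2, 3, 4, 5, 6, 7, 8, 9, 10}" by auto
  show ?thesis
    by (rule planar_embedding_straight[OF tail_ends_matching]; (elim insertE emptyE)?)
      (simp_all add: verts far_matching_pos_def matching_ends_def doubleton_eq_iff)
qed

lemma planar_path:
  "planar_embedding theta_path (straight_pos path_pos)
    (straight_curve (\<lambda>e. real e) (\<lambda>e. real e + 1))"
proof -
  have verts: "{2..<9::nat} = {2, 3, 4, 5, 6, 7, 8}" by auto
  show ?thesis
    by (rule planar_embedding_straight[OF tail_ends_path]; (elim insertE emptyE)?)
      (simp_all add: verts path_pos_def path_ends_def doubleton_eq_iff)
qed

lemma common_dual_pendants_matching: "common_dual theta_pendants theta_matching"
proof -
  note iso = isomorphic_straight_duals[OF tail_ends_pendant tail_ends_matching planar_pendants planar_near_matching]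
  show ?thesis
    unfolding common_dual_def
    by (rule exI)+ (rule conjI[OF planar_pendants conjI[OF planar_near_matching iso]], auto)
qed

lemma common_dual_matching_path: "common_dual theta_matching theta_path"
proof -
  note iso = isomorphic_straight_duals[OF tail_ends_matching tail_ends_path planar_far_matching planar_path]
  show ?thesis
    unfolding common_dual_def
    by (rule exI)+ (rule conjI[OF planar_far_matching conjI[OF planar_path iso]], auto)
qed

section \<open>Why the pendant graph and the path graph have no common dual\<close>

text \<open>The three path edges form a connected set, disjoint from the base because their vertices
  5 to 8 are not theta vertices. Such a set lies in a single base face.\<close>

lemma path_tails_same_dual_ends:
  assumes "planar_embedding theta_path p c"
  obtains X where "\<forall>e \<in> {6, 7, 8}. ends (dual_graph theta_path p c) e = {X}"
proof -
  interpret tailed_theta_embedding 9 path_ends p c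
    using tail_ends_path assms by (rule tailed_theta_embeddingI)
  have tails: "tails = path_image (c 6) \<union> path_image (c 7) \<union> path_image (c 8)"
    by (simp add: tail_edges_eq Un_assoc)
  have conn: "connected (path_image (c e))" if "e < 9" for e
    using that by (intro connected_path_image path_edge) simp
  have "path_image (c 6) \<inter> path_image (c 7) = p ` {6}" "path_image (c 7) \<inter> path_image (c 8) = p ` {7}"
    by (subst path_image_edge_Int; simp add: path_ends_def)+
  then have "connected (path_image (c 6) \<union> path_image (c 7) \<union> path_image (c 8))"
    by (intro connected_Un conn) auto
  then have "connected tails"
    by (simp only: tails)
  moreover have "path_image (c e) \<inter> base = {}" if "e \<in> {6, 7, 8}" for e
  proof -
    have e: "e \<in> edges theta_path" "{..<6} \<subseteq> edges theta_path" "e \<notin> {..<6}"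
      using that by auto
    have "path_image (c e) \<inter> base = p ` (path_ends e \<inter> {..<5})"
      using path_image_edge_Int_drawing[OF e] e(3) by (simp only: Union_base_ends) simp
    moreover have "path_ends e \<inter> {..<5} = {}"
      using that by (auto simp: path_ends_def)
    ultimately show ?thesis by simp
  qed
  then have "tails \<subseteq> - base"
    unfolding tails by blast
  ultimately have in_face: "tails \<subseteq> F" if "F \<in> components (- base)" "F \<inter> tails \<noteq> {}" for F
    using that components_maximal by blast
  have tail_face: "\<exists>F. F \<in> components (- base) \<and> tails \<subseteq> F \<and>
      ends (dual_graph theta_path p c) e = {F - tails}" if "e \<in> {6, 7, 8}" for e
  proof -
    have e: "e \<in> {6..<9}" using that by auto
    obtain F where F: "F \<in> components (- base)" "open_curve (c e) \<subseteq> F"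
      "ends (dual_graph theta_path p c) e = {F - tails}"
      using dual_tail_edge[OF e] by blast
    have "open_curve (c e) \<subseteq> tails"
      using open_curve_subset_path_image that unfolding tails by blast
    then have "F \<inter> tails \<noteq> {}"
      using F(2) open_curve_nonempty by blast
    then show ?thesis using F in_face by blast
  qed
  obtain F where F: "F \<in> components (- base)" "tails \<subseteq> F"
    using tail_face[of 6] by blast
  have "ends (dual_graph theta_path p c) e = {F - tails}" if "e \<in> {6, 7, 8}" for e
  proof -
    obtain F' where F': "F' \<in> components (- base)" "tails \<subseteq> F'"
      "ends (dual_graph theta_path p c) e = {F' - tails}"
      using tail_face[OF \<open>e \<in> {6, 7, 8}\<close>] by blast
    have "tails \<noteq> {}"
      by (simp add: tails)
    then have "F' = F"
      using components_nonoverlap F F' by blast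
    then show ?thesis using F' by simp
  qed
  then have "\<forall>e \<in> {6, 7, 8}. ends (dual_graph theta_path p c) e = {F - tails}"
    by (rule ballI)
  then show ?thesis by (rule that)
qed

text \<open>Since \<open>F \<mapsto> F - tails\<close> is injective on base faces, a common dual end
  would put all three pendant edges into one base face, whose closure would contain all three middle
  vertices.\<close>

lemma pendants_distinct_dual_ends:
  assumes "planar_embedding theta_pendants p c"
  shows "\<not> (\<forall>e \<in> {6, 7, 8}. ends (dual_graph theta_pendants p c) e = {Y})"
proof
  assume Y: "\<forall>e \<in> {6, 7, 8}. ends (dual_graph theta_pendants p c) e = {Y}"
  interpret tailed_theta_embedding 8 pendant_ends p c
    using tail_ends_pendant assms by (rule tailed_theta_embeddingI)
  have tail_face: "\<exists>F. F \<in> components (- base) \<and> open_curve (c e) \<subseteq> F \<and> F - tails = Y"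
    if "e \<in> {6, 7, 8}" for e
  proof -
    have e: "e \<in> {6..<9}" using that by auto
    obtain F where F: "F \<in> components (- base)" "open_curve (c e) \<subseteq> F"
      "ends (dual_graph theta_pendants p c) e = {F - tails}"
      using dual_tail_edge[OF e] by blast
    moreover have "ends (dual_graph theta_pendants p c) e = {Y}"
      using bspec[OF Y \<open>e \<in> {6, 7, 8}\<close>] .
    ultimately show ?thesis by blast
  qed
  obtain F where F: "F \<in> components (- base)" "F - tails = Y"
    using tail_face[of 6] by blast
  \<comment> \<open>\<open>e - 4\<close> is the middle vertex to which the pendant edge
    \<open>e\<close> is attached.\<close>
  have "p (e - 4) \<in> closure F" if "e \<in> {6, 7, 8}" for e
  proof -
    have e: "e \<in> edges theta_pendants" "6 \<le> e" using that by auto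
    obtain F' where "F' \<in> components (- base)" "open_curve (c e) \<subseteq> F'" "F' - tails = Y"
      using tail_face[OF \<open>e \<in> {6, 7, 8}\<close>] by blast
    then have "open_curve (c e) \<subseteq> F"
      using F tail.inj_on_face_minus_addition by (metis inj_onD)
    then have "path_image (c e) \<subseteq> closure F"
      using path_image_subset_closure_open_curve[OF path_edge[OF e(1)]] closure_mono by blast
    moreover have "p (e - 4) \<in> path_image (c e)"
      unfolding path_image_edge[OF e(1)] using e(2) by (simp add: pendant_ends_def)
    ultimately show ?thesis by blast
  qed
  from this[of 6] this[of 7] this[of 8] have "p ` {2, 3, 4} \<subseteq> closure F"
    by simp
  then show False
    using middle_vertices_not_cofacial[OF F(1)] by blast
qed

lemma not_common_dual_pendants_path: "\<not> common_dual theta_pendants theta_path"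
proof
  assume "common_dual theta_pendants theta_path"
  then obtain p\<^sub>1 c\<^sub>1 p\<^sub>3 c\<^sub>3 where
    emb\<^sub>1: "planar_embedding theta_pendants p\<^sub>1 c\<^sub>1" and emb\<^sub>3: "planar_embedding theta_path p\<^sub>3 c\<^sub>3"
    and iso: "isomorphic_multigraphs (dual_graph theta_pendants p\<^sub>1 c\<^sub>1) (dual_graph theta_path p\<^sub>3 c\<^sub>3)"
    unfolding common_dual_def by blast
  interpret G: tailed_theta_embedding 8 pendant_ends p\<^sub>1 c\<^sub>1
    using tail_ends_pendant emb\<^sub>1 by (rule tailed_theta_embeddingI)
  let ?D = "dual_graph theta_pendants p\<^sub>1 c\<^sub>1" and ?D' = "dual_graph theta_path p\<^sub>3 c\<^sub>3"
  obtain f g where f: "bij_betw f (verts ?D) (verts ?D')" and g: "bij_betw g {..<9} {..<9}"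
    and fg: "\<And>e. e < 9 \<Longrightarrow> ends ?D' (g e) = f ` ends ?D e"
    using iso by (auto simp: isomorphic_multigraphs_def dual_graph_def)
  obtain X where X: "\<forall>e \<in> {6, 7, 8}. ends ?D' e = {X}"
    using path_tails_same_dual_ends[OF emb\<^sub>3] .
  have dual_ends: "ends ?D e \<subseteq> verts ?D" for e
    by (auto simp: dual_graph_def)
  \<comment> \<open>An edge mapped to a path tail must itself be a loop of the dual, as
    \<open>f\<close> is injective, and so it cannot be a base edge.\<close>
  have tail_edge: "e \<in> {6, 7, 8} \<and> f ` ends ?D e = {X}" if "e < 9" "g e \<in> {6, 7, 8}" for e
  proof -
    have fX: "f ` ends ?D e = {X}"
      using fg[OF that(1)] X that(2) by metis
    have "inj_on f (ends ?D e)"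
      using f dual_ends inj_on_subset by (metis bij_betw_imp_inj_on)
    then have "card (ends ?D e) = 1"
      using fX card_image by fastforce
    then have "\<not> e < 6"
      using G.card_dual_base_edge by blast
    then show ?thesis using fX that(1) by auto
  qed
  have surj: "\<exists>e. e < 9 \<and> g e = i" if "i < 9" for i
    using g that unfolding bij_betw_def by (metis imageE lessThan_iff)
  obtain e\<^sub>6 e\<^sub>7 e\<^sub>8 where e: "e\<^sub>6 < 9" "g e\<^sub>6 = 6" "e\<^sub>7 < 9" "g e\<^sub>7 = 7" "e\<^sub>8 < 9" "g e\<^sub>8 = 8"
    using surj[of 6] surj[of 7] surj[of 8] by auto
  then have "e\<^sub>6 \<noteq> e\<^sub>7" "e\<^sub>6 \<noteq> e\<^sub>8" "e\<^sub>7 \<noteq> e\<^sub>8"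
    by auto
  moreover have "e\<^sub>6 \<in> {6, 7, 8}" "e\<^sub>7 \<in> {6, 7, 8}" "e\<^sub>8 \<in> {6, 7, 8}"
    using tail_edge e by auto
  \<comment> \<open>Three distinct preimages within a three-element set exhaust it, so every pendant
    edge is a loop at the preimage of \<open>X\<close>.\<close>
  ultimately have tails_eq: "{6, 7, 8} = {e\<^sub>6, e\<^sub>7, e\<^sub>8}"
    by auto
  have images: "f ` ends ?D e\<^sub>6 = {X}" "f ` ends ?D e\<^sub>7 = {X}" "f ` ends ?D e\<^sub>8 = {X}"
    using tail_edge[of e\<^sub>6] tail_edge[of e\<^sub>7] tail_edge[of e\<^sub>8] e by simp_all
  have fX: "f ` ends ?D e = {X}" if "e \<in> {6, 7, 8}" for e
    using that[unfolded tails_eq] images by (elim insertE emptyE) (simp_all only:)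
  have inj: "inj_on f (verts ?D)"
    using f by (simp add: bij_betw_def)
  have "\<forall>e \<in> {6, 7, 8}. ends ?D e = {inv_into (verts ?D) f X}"
  proof
    fix e :: nat assume e: "e \<in> {6, 7, 8}"
    have "ends ?D e = inv_into (verts ?D) f ` f ` ends ?D e"
      using inv_into_image_cancel[OF inj dual_ends] by simp
    then show "ends ?D e = {inv_into (verts ?D) f X}"
      by (simp only: fX[OF e] image_insert image_empty)
  qed
  then show False
    using pendants_distinct_dual_ends[OF emb\<^sub>1] by (rule notE[rotated])
qed

theorem theorem9:
  "\<exists>(G\<^sub>1 :: (nat, nat) multigraph) (G\<^sub>2 :: (nat, nat) multigraph) (G\<^sub>3 :: (nat, nat) multigraph).
     planar_graph G\<^sub>1 \<and> planar_graph G\<^sub>2 \<and> planar_graph G\<^sub>3 \<and>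
     common_dual G\<^sub>1 G\<^sub>2 \<and> common_dual G\<^sub>2 G\<^sub>3 \<and> \<not> common_dual G\<^sub>1 G\<^sub>3"
proof (rule exI[of _ theta_pendants], rule exI[of _ theta_matching], rule exI[of _ theta_path], intro conjI)
  show "planar_graph theta_pendants"
    by (rule planar_graph_tailed_theta[OF tail_ends_pendant planar_pendants])
  show "planar_graph theta_matching"
    by (rule planar_graph_tailed_theta[OF tail_ends_matching planar_near_matching])
  show "planar_graph theta_path"
    by (rule planar_graph_tailed_theta[OF tail_ends_path planar_path])
qed (fact common_dual_pendants_matching common_dual_matching_path not_common_dual_pendants_path)+

end
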